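(* Let $n\ge 1$ be an integer and let $V(\mathbf{t}) = V(t_1,\ldots,t_n)$ be the Vandermonde polynomial, for $t_1,\ldots,t_n\in\mathbb{R}$. Then $E_k V(\mathbf{t}) = 0$ for all $k=1,\ldots,n$, where $E_k$ is the differential operator $$E_k := \sum_{1\le i_1<\cdots<i_k\le n} \frac{\partial^k}{\partial t_{i_1}\cdots\partial t_{i_k}} .$$
   Context: The Vandermonde polynomial is $V(t_1,\ldots,t_n) := \prod_{1\le i<j\le n}(t_j-t_i)$ (the empty product is $1$, so $V=1$ when $n=1$). *)

theory Defs
  imports "HOL-Analysis.Analysis"
begin

text \<open>
  A point \<open>(t\<^sub>1, \<dots>, t\<^sub>n)\<close> of real \<open>n\<close>-space is a function \<open>t :: nat \<Rightarrow> real\<close>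
  of which only the values at the indices \<open>1, \<dots>, n\<close> are ever used.
\<close>

definition vandermonde :: "nat \<Rightarrow> (nat \<Rightarrow> real) \<Rightarrow> real" where
  "vandermonde n t = (\<Prod>(i, j) \<in> {(i, j). 1 \<le> i \<and> i < j \<and> j \<le> n}. t j - t i)"

definition partial_deriv :: "nat \<Rightarrow> ((nat \<Rightarrow> real) \<Rightarrow> real) \<Rightarrow> (nat \<Rightarrow> real) \<Rightarrow> real" where
  "partial_deriv i f t = deriv (\<lambda>x. f (t(i := x))) (t i)"

text \<open>
  For a list \<open>[i\<^sub>1, \<dots>, i\<^sub>k]\<close> this is the composition of the partial derivatives
  in the variables \<open>i\<^sub>1, \<dots>, i\<^sub>k\<close>, the one in \<open>i\<^sub>k\<close> being applied first.
\<close>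

definition iterated_partial_deriv ::
    "nat list \<Rightarrow> ((nat \<Rightarrow> real) \<Rightarrow> real) \<Rightarrow> (nat \<Rightarrow> real) \<Rightarrow> real" where
  "iterated_partial_deriv is f = foldr partial_deriv is f"

definition increasing_indices :: "nat \<Rightarrow> nat \<Rightarrow> nat list set" where
  "increasing_indices n k =
     {is. length is = k \<and> sorted_wrt (<) is \<and> set is \<subseteq> {1..n}}"

definition elem_diff_op ::
    "nat \<Rightarrow> nat \<Rightarrow> ((nat \<Rightarrow> real) \<Rightarrow> real) \<Rightarrow> (nat \<Rightarrow> real) \<Rightarrow> real" where
  "elem_diff_op n k f t = (\<Sum>is \<in> increasing_indices n k. iterated_partial_deriv is f t)"

text \<open>The index sets of the product and of the sum are finite, so neither degenerates.\<close>

lemma finite_vandermonde_pairs: "finite {(i, j). 1 \<le> i \<and> i < j \<and> j \<le> (n::nat)}"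
  by (rule finite_subset[of _ "{..n} \<times> {..n}"]) auto

lemma finite_increasing_indices: "finite (increasing_indices n k)"
  by (rule finite_subset[OF _ finite_lists_length_eq[of "{1..n}" k]])
     (auto simp: increasing_indices_def)

end

theory Submission
  imports Defs "Jordan_Normal_Form.Determinant"
begin

text \<open>
  Why the operators kill \<open>V\<close>: collect them in the generating function
  \<open>\<Sum>\<^sub>k u^k E\<^sub>k = \<Prod>\<^sub>i (1 + u \<partial>\<^sub>i)\<close>. Now \<open>V\<close> is the determinant of
  the matrix with entries \<open>t\<^sub>i^j\<close> (\<open>0 \<le> j < n\<close>), in which the variable \<open>t\<^sub>i\<close> occurs only in
  row \<open>i\<close>. Every term of its Leibniz expansion has one factor from each row, so the product of operators acts row by row, replacing every entry \<open>p(t\<^sub>i)\<close> by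
  \<open>p(t\<^sub>i) + u p'(t\<^sub>i)\<close>. The polynomial \<open>p + u p'\<close> is again monic, of the same degree as \<open>p\<close>,
  and the determinant of the values of monic polynomials of degrees \<open>0, \<dots>, n - 1\<close> is \<open>V\<close>
  whichever monic polynomials are taken. Therefore \<open>\<Sum>\<^sub>k u^k E\<^sub>k V = V\<close> for every real \<open>u\<close>, and
  comparing the coefficients of \<open>u^k\<close> for \<open>k \<ge> 1\<close> gives the claim.

  The independence of the monic family is used twice. With the family
  \<open>(X - t\<^sub>1) \<cdots> (X - t\<^sub>j)\<close> the matrix is triangular, which evaluates the determinant
  (\<open>det_monic_eval\<close>); with \<open>p + u p'\<close> it gives the invariance under the generating function
  (\<open>vandermonde_generating_function\<close>). That the generating function acts row by row is
  \<open>elem_diff_op_generating_function\<close>.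
\<close>

section \<open>Determinants of monic families of polynomials\<close>

text \<open>
  Passing from the powers of \<open>X\<close> to another monic family multiplies the matrix of values by
  the matrix of coefficients, which is upper triangular with diagonal \<open>1\<close>.
\<close>

lemma det_monic_eval_eq_det_powers:
  fixes p :: "nat \<Rightarrow> 'a::comm_ring_1 poly" and x :: "nat \<Rightarrow> 'a"
  assumes deg: "\<And>j. j < n \<Longrightarrow> degree (p j) = j" and monic: "\<And>j. j < n \<Longrightarrow> lead_coeff (p j) = 1"
  shows "Determinant.det (Matrix.mat n n (\<lambda>(i, j). poly (p j) (x i))) =
         Determinant.det (Matrix.mat n n (\<lambda>(i, j). x i ^ j))"
proof -
  let ?M = "Matrix.mat n n (\<lambda>(i, j). x i ^ j)"
  let ?C = "Matrix.mat n n (\<lambda>(l, j). coeff (p j) l)"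
  have "Matrix.mat n n (\<lambda>(i, j). poly (p j) (x i)) = ?M * ?C"
  proof (rule eq_matI)
    fix i j assume "i < dim_row (?M * ?C)" "j < dim_col (?M * ?C)"
    then have ij: "i < n" "j < n" by auto
    have "poly (p j) (x i) = (\<Sum>l\<le>j. coeff (p j) l * x i ^ l)"
      using deg[OF ij(2)] by (simp add: poly_altdef)
    also have "\<dots> = (\<Sum>l\<in>{0..<n}. coeff (p j) l * x i ^ l)"
      using ij deg[OF ij(2)] by (intro sum.mono_neutral_left) (auto simp: coeff_eq_0)
    finally show "Matrix.mat n n (\<lambda>(i, j). poly (p j) (x i)) $$ (i, j) = (?M * ?C) $$ (i, j)"
      using ij by (simp add: scalar_prod_def mult.commute)
  qed auto
  moreover have "Determinant.det ?C = 1"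
  proof -
    have "Determinant.det ?C = prod_list (diag_mat ?C)"
      using deg by (intro det_upper_triangular[of _ n]) (auto simp: coeff_eq_0)
    also have "\<dots> = (\<Prod>j\<in>{0..<n}. ?C $$ (j, j))"
      by (simp add: prod_list_diag_prod)
    also have "\<dots> = 1"
      using deg monic by (intro prod.neutral) fastforce
    finally show ?thesis .
  qed
  ultimately show ?thesis
    by (simp add: det_mult[of _ n])
qed

text \<open>
  The value of the determinant is the same for all monic families, so it can be read off from
  one for which the matrix is triangular.
\<close>

lemma det_monic_eval:
  fixes p :: "nat \<Rightarrow> 'a::idom poly" and x :: "nat \<Rightarrow> 'a"
  assumes deg: "\<And>j. j < n \<Longrightarrow> degree (p j) = j" and monic: "\<And>j. j < n \<Longrightarrow> lead_coeff (p j) = 1"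
  shows "Determinant.det (Matrix.mat n n (\<lambda>(i, j). poly (p j) (x i))) =
         (\<Prod>j<n. \<Prod>i<j. x j - x i)"
proof -
  (* The Newton polynomials at the nodes x: the j-th vanishes at x i for i < j. *)
  define w where "w j = (\<Prod>l<j. [:- x l, 1:])" for j
  have deg_w: "degree (w j) = j" for j
    unfolding w_def by (subst degree_prod_eq_sum_degree) auto
  have monic_w: "lead_coeff (w j) = 1" for j
    unfolding w_def by (subst lead_coeff_prod) auto
  let ?W = "Matrix.mat n n (\<lambda>(i, j). poly (w j) (x i))"
  have "Determinant.det (Matrix.mat n n (\<lambda>(i, j). poly (p j) (x i))) = Determinant.det ?W"
    using det_monic_eval_eq_det_powers[of n p x] det_monic_eval_eq_det_powers[of n w x]
      deg monic deg_w monic_w by simp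
  also have "\<dots> = prod_list (diag_mat ?W)"
    by (rule det_lower_triangular[of n]) (auto simp: w_def poly_prod)
  also have "\<dots> = (\<Prod>j<n. poly (w j) (x j))"
    by (simp add: prod_list_diag_prod atLeast0LessThan)
  also have "\<dots> = (\<Prod>j<n. \<Prod>i<j. x j - x i)"
    by (simp add: w_def poly_prod)
  finally show ?thesis .
qed

lemma vandermonde_eq_nested_prod:
  "vandermonde n t = (\<Prod>j<n. \<Prod>i<j. t (Suc j) - t (Suc i))"
proof -
  have "(\<Prod>j<n. \<Prod>i<j. t (Suc j) - t (Suc i)) =
        (\<Prod>(j, i)\<in>(SIGMA j:{..<n}. {..<j}). t (Suc j) - t (Suc i))"
    by (subst prod.Sigma) auto
  also have "\<dots> = vandermonde n t"
    unfolding vandermonde_def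
    by (rule prod.reindex_bij_witness[where i = "\<lambda>(i, j). (j - 1, i - 1)"
          and j = "\<lambda>(j, i). (Suc i, Suc j)"]) auto
  finally show ?thesis ..
qed

text \<open>
  The monic family is left arbitrary: the proof compares the expansions for two different ones.
  Rows and columns of the matrix are numbered from \<open>0\<close>, the variables from \<open>1\<close>; hence the
  shift in \<open>\<sigma> (i - 1)\<close>.
\<close>

lemma vandermonde_leibniz:
  fixes p :: "nat \<Rightarrow> real poly"
  assumes "\<And>j. j < n \<Longrightarrow> degree (p j) = j" and "\<And>j. j < n \<Longrightarrow> lead_coeff (p j) = 1"
  shows "vandermonde n t =
    (\<Sum>\<sigma> | \<sigma> permutes {0..<n}. signof \<sigma> * (\<Prod>i\<in>{1..n}. poly (p (\<sigma> (i - 1))) (t i)))"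
proof -
  let ?A = "Matrix.mat n n (\<lambda>(i, j). poly (p j) (t (Suc i)))"
  have "vandermonde n t = Determinant.det ?A"
    using det_monic_eval[of n p "\<lambda>i. t (Suc i)"] assms by (simp add: vandermonde_eq_nested_prod)
  also have "\<dots> = (\<Sum>\<sigma> | \<sigma> permutes {0..<n}. signof \<sigma> * (\<Prod>i = 0..<n. ?A $$ (i, \<sigma> i)))"
    by (rule det_def') simp
  also have "\<dots> = (\<Sum>\<sigma> | \<sigma> permutes {0..<n}. signof \<sigma> * (\<Prod>i\<in>{1..n}. poly (p (\<sigma> (i - 1))) (t i)))"
  proof (intro sum.cong refl arg_cong2[where f = "(*)"])
    fix \<sigma> assume "\<sigma> \<in> {\<sigma>. \<sigma> permutes {0..<n}}"
    then have "\<sigma> i < n" if "i < n" for i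
      using that permutes_in_image[of \<sigma> "{0..<n}" i] by auto
    then show "(\<Prod>i = 0..<n. ?A $$ (i, \<sigma> i)) = (\<Prod>i\<in>{1..n}. poly (p (\<sigma> (i - 1))) (t i))"
      by (intro prod.reindex_bij_witness[where i = "\<lambda>i. i - 1" and j = Suc]) auto
  qed
  finally show ?thesis .
qed

section \<open>Differentiating sums of separated products\<close>

text \<open>
  The shape of the Leibniz expansion of a determinant whose row \<open>i\<close> involves only the
  variable \<open>t i\<close>. The functions of this shape are closed under partial derivatives, which only
  change the polynomials \<open>q \<sigma> i\<close>.
\<close>

definition separated_sum ::
    "'b set \<Rightarrow> ('b \<Rightarrow> real) \<Rightarrow> nat set \<Rightarrow> ('b \<Rightarrow> nat \<Rightarrow> real poly) \<Rightarrow> (nat \<Rightarrow> real) \<Rightarrow> real" where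
  "separated_sum P c I q t = (\<Sum>\<sigma>\<in>P. c \<sigma> * (\<Prod>i\<in>I. poly (q \<sigma> i) (t i)))"

lemma partial_deriv_separated_sum:
  assumes I: "finite I" "m \<in> I"
  shows "partial_deriv m (separated_sum P c I q) =
         separated_sum P c I (\<lambda>\<sigma> i. if i = m then pderiv (q \<sigma> i) else q \<sigma> i)"
proof
  fix t
  define r where "r \<sigma> = (\<Prod>i\<in>I - {m}. poly (q \<sigma> i) (t i))" for \<sigma>
  have "separated_sum P c I q (t(m := x)) = (\<Sum>\<sigma>\<in>P. c \<sigma> * (poly (q \<sigma> m) x * r \<sigma>))" for x
    unfolding separated_sum_def r_def using I
    by (intro sum.cong refl) (simp add: prod.remove[of I m])
  moreover have "((\<lambda>x. \<Sum>\<sigma>\<in>P. c \<sigma> * (poly (q \<sigma> m) x * r \<sigma>)) has_field_derivative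
        (\<Sum>\<sigma>\<in>P. c \<sigma> * (poly (pderiv (q \<sigma> m)) (t m) * r \<sigma>))) (at (t m))"
    by (auto intro!: derivative_eq_intros poly_DERIV simp: mult_ac)
  moreover have "(\<Sum>\<sigma>\<in>P. c \<sigma> * (poly (pderiv (q \<sigma> m)) (t m) * r \<sigma>)) =
      separated_sum P c I (\<lambda>\<sigma> i. if i = m then pderiv (q \<sigma> i) else q \<sigma> i) t"
    unfolding separated_sum_def r_def using I
    by (intro sum.cong refl) (simp add: prod.remove[of I m])
  ultimately show "partial_deriv m (separated_sum P c I q) t =
      separated_sum P c I (\<lambda>\<sigma> i. if i = m then pderiv (q \<sigma> i) else q \<sigma> i) t"
    by (simp add: partial_deriv_def DERIV_imp_deriv)
qed

lemma iterated_partial_deriv_separated_sum: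
  assumes "finite I" "set is \<subseteq> I" "distinct is"
  shows "iterated_partial_deriv is (separated_sum P c I q) =
         separated_sum P c I (\<lambda>\<sigma> i. if i \<in> set is then pderiv (q \<sigma> i) else q \<sigma> i)"
  using assms(2,3)
proof (induction "is")
  case Nil
  then show ?case by (simp add: iterated_partial_deriv_def)
next
  case (Cons m ms)
  have "iterated_partial_deriv (m # ms) (separated_sum P c I q) =
        partial_deriv m (iterated_partial_deriv ms (separated_sum P c I q))"
    by (simp add: iterated_partial_deriv_def)
  also have "\<dots> = separated_sum P c I (\<lambda>\<sigma> i. if i = m
      then pderiv (if i \<in> set ms then pderiv (q \<sigma> i) else q \<sigma> i)
      else if i \<in> set ms then pderiv (q \<sigma> i) else q \<sigma> i)"
    using Cons assms(1) by (simp add: partial_deriv_separated_sum)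
  also have "(\<lambda>\<sigma> i. if i = m
      then pderiv (if i \<in> set ms then pderiv (q \<sigma> i) else q \<sigma> i)
      else if i \<in> set ms then pderiv (q \<sigma> i) else q \<sigma> i) =
      (\<lambda>\<sigma> i. if i \<in> set (m # ms) then pderiv (q \<sigma> i) else q \<sigma> i)"
    using Cons.prems by (auto simp: fun_eq_iff)
  finally show ?case .
qed

section \<open>The generating function of the operators\<close>

lemma elem_diff_op_eq_sum_subsets:
  "elem_diff_op n k f t =
     (\<Sum>S | S \<subseteq> {1..n} \<and> card S = k. iterated_partial_deriv (sorted_list_of_set S) f t)"
  unfolding elem_diff_op_def
proof (rule sum.reindex_bij_witness[where i = sorted_list_of_set and j = set])
  fix xs assume "xs \<in> increasing_indices n k"
  then have xs: "length xs = k" "sorted_wrt (<) xs" "set xs \<subseteq> {1..n}"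
    by (auto simp: increasing_indices_def)
  then show "sorted_list_of_set (set xs) = xs"
    by (simp add: sorted_list_of_set.idem_if_sorted_distinct strict_sorted_iff)
  then show "iterated_partial_deriv (sorted_list_of_set (set xs)) f t = iterated_partial_deriv xs f t"
    by simp
  show "set xs \<in> {S. S \<subseteq> {1..n} \<and> card S = k}"
    using xs by (simp add: strict_sorted_iff distinct_card)
next
  fix S assume "S \<in> {S. S \<subseteq> {1..n} \<and> card S = k}"
  moreover from this have "finite S" by (auto intro: finite_subset)
  ultimately show "set (sorted_list_of_set S) = S" "sorted_list_of_set S \<in> increasing_indices n k"
    by (auto simp: increasing_indices_def)
qed

text \<open>
  This is \<open>\<Sum>\<^sub>k u^k E\<^sub>k = \<Prod>\<^sub>i (1 + u \<partial>\<^sub>i)\<close>: expanding the product over \<open>i\<close> of the values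
  \<open>q\<^sub>i(t\<^sub>i) + u q\<^sub>i'(t\<^sub>i)\<close> chooses a set \<open>S\<close> of variables to differentiate, with weight \<open>u^card S\<close>.
\<close>

lemma elem_diff_op_generating_function:
  "(\<Sum>k\<le>n. elem_diff_op n k (separated_sum P c {1..n} q) t * u ^ k) =
     separated_sum P c {1..n} (\<lambda>\<sigma> i. q \<sigma> i + Polynomial.smult u (pderiv (q \<sigma> i))) t"
proof -
  let ?I = "{1..n}"
  let ?f = "separated_sum P c ?I q"
  have deriv: "iterated_partial_deriv (sorted_list_of_set S) ?f t * u ^ card S =
      (\<Sum>\<sigma>\<in>P. c \<sigma> * ((\<Prod>i\<in>S. u * poly (pderiv (q \<sigma> i)) (t i)) *
                              (\<Prod>i\<in>?I - S. poly (q \<sigma> i) (t i))))"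
    if S: "S \<subseteq> ?I" for S
  proof -
    have "finite S" using S by (rule finite_subset) simp
    then have "iterated_partial_deriv (sorted_list_of_set S) ?f t =
        separated_sum P c ?I (\<lambda>\<sigma> i. if i \<in> S then pderiv (q \<sigma> i) else q \<sigma> i) t"
      using S by (simp add: iterated_partial_deriv_separated_sum)
    also have "\<dots> = (\<Sum>\<sigma>\<in>P. c \<sigma> * ((\<Prod>i\<in>S. poly (pderiv (q \<sigma> i)) (t i)) *
                              (\<Prod>i\<in>?I - S. poly (q \<sigma> i) (t i))))"
      unfolding separated_sum_def
      by (intro sum.cong refl arg_cong2[where f = "(*)"], subst prod.subset_diff[OF S])
         (auto simp: mult.commute intro!: arg_cong2[where f = "(*)"] prod.cong)
    finally show ?thesis
      by (simp add: sum_distrib_left sum_distrib_right prod.distrib mult_ac)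
  qed
  have "(\<Sum>k\<le>n. elem_diff_op n k ?f t * u ^ k) =
      (\<Sum>k\<le>n. \<Sum>S | S \<in> Pow ?I \<and> card S = k.
         iterated_partial_deriv (sorted_list_of_set S) ?f t * u ^ card S)"
    by (simp add: elem_diff_op_eq_sum_subsets sum_distrib_right)
  also have "\<dots> = (\<Sum>S\<in>Pow ?I. iterated_partial_deriv (sorted_list_of_set S) ?f t * u ^ card S)"
    by (rule sum.group) (auto dest: card_mono[rotated])
  also have "\<dots> = (\<Sum>S\<in>Pow ?I. \<Sum>\<sigma>\<in>P. c \<sigma> * ((\<Prod>i\<in>S. u * poly (pderiv (q \<sigma> i)) (t i)) *
                              (\<Prod>i\<in>?I - S. poly (q \<sigma> i) (t i))))"
    using deriv by (intro sum.cong refl) blast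
  also have "\<dots> = (\<Sum>\<sigma>\<in>P. c \<sigma> * (\<Prod>i\<in>?I. u * poly (pderiv (q \<sigma> i)) (t i) + poly (q \<sigma> i) (t i)))"
    by (subst sum.swap) (simp add: prod_add sum_distrib_left)
  also have "\<dots> = separated_sum P c ?I (\<lambda>\<sigma> i. q \<sigma> i + Polynomial.smult u (pderiv (q \<sigma> i))) t"
    by (simp add: separated_sum_def add.commute)
  finally show ?thesis .
qed

section \<open>Vanishing on the Vandermonde polynomial\<close>

lemma degree_add_smult_pderiv:
  fixes p :: "'a::field_char_0 poly"
  shows "degree (p + Polynomial.smult u (pderiv p)) = degree p"
proof (cases "degree p = 0")
  case True
  then have "pderiv p = 0" by (simp add: pderiv_eq_0_iff)
  then show ?thesis by simp
next
  case False
  then have "degree (Polynomial.smult u (pderiv p)) < degree p"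
    by (simp add: degree_pderiv)
  then show ?thesis by (rule degree_add_eq_left)
qed

lemma lead_coeff_add_smult_pderiv:
  fixes p :: "'a::field_char_0 poly"
  shows "lead_coeff (p + Polynomial.smult u (pderiv p)) = lead_coeff p"
  by (simp add: degree_add_smult_pderiv coeff_pderiv coeff_eq_0)

text \<open>
  The operator \<open>1 + u d/dX\<close> turns the powers of \<open>X\<close> into another monic family, and \<open>V\<close> is the
  determinant of either.
\<close>

lemma vandermonde_generating_function:
  "(\<Sum>k\<le>n. elem_diff_op n k (vandermonde n) t * u ^ k) = vandermonde n t"
proof -
  define P where "P = {\<sigma>. \<sigma> permutes {0..<n}}"
  define c :: "(nat \<Rightarrow> nat) \<Rightarrow> real" where "c \<sigma> = signof \<sigma>" for \<sigma>
  define p :: "nat \<Rightarrow> real poly" where "p j = monom 1 j" for j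
  have eq: "vandermonde n = separated_sum P c {1..n} (\<lambda>\<sigma> i. r (\<sigma> (i - 1)))"
    if "\<And>j. degree (r j) = j" "\<And>j. lead_coeff (r j) = 1" for r
    using vandermonde_leibniz[of n r] that
    by (simp add: fun_eq_iff separated_sum_def P_def c_def)
  have p: "degree (p j) = j" "lead_coeff (p j) = 1" for j
    by (simp_all add: p_def degree_monom_eq)
  have "(\<Sum>k\<le>n. elem_diff_op n k (vandermonde n) t * u ^ k) =
      separated_sum P c {1..n} (\<lambda>\<sigma> i. p (\<sigma> (i - 1)) + Polynomial.smult u (pderiv (p (\<sigma> (i - 1))))) t"
    by (simp only: eq[of p, OF p] elem_diff_op_generating_function)
  also have "\<dots> = vandermonde n t"
    by (rule eq[THEN fun_cong, symmetric])
      (rule degree_add_smult_pderiv[THEN trans] lead_coeff_add_smult_pderiv[THEN trans], rule p)+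
  finally show ?thesis .
qed

theorem lemma5:
  fixes n k :: nat and t :: "nat \<Rightarrow> real"
  assumes "n \<ge> 1" and "k \<in> {1..n}"
  shows "elem_diff_op n k (vandermonde n) t = 0"
proof -
  have "(\<Sum>k\<le>n. elem_diff_op n k (vandermonde n) t * u ^ k) =
        (\<Sum>k\<le>n. (if k = 0 then vandermonde n t else 0) * u ^ k)" for u :: real
    by (simp add: vandermonde_generating_function if_distrib[of "\<lambda>x. x * _"] cong: if_cong)
  then have "\<forall>k\<le>n. elem_diff_op n k (vandermonde n) t = (if k = 0 then vandermonde n t else 0)"
    by (subst polyfun_eq_coeffs[symmetric]) blast
  then show ?thesis using assms(2) by simp
qed

end
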